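(* Let $n$ be odd with $2n+1$ prime, and let $g$ be a primitive root modulo $2n+1$. For $i = 1, 2, \ldots, n$ let $c_i \in \mathbb{Z}_{2n}$ be the discrete logarithm of $i$ to base $g$ (i.e. $g^{c_i} \equiv i \pmod{2n+1}$), and let $d_i \in \mathbb{Z}_n$ be the reduction of $c_i$ modulo $n$. Then $(d_1, d_2, \ldots, d_n)$ is a terrace for $\mathbb{Z}_n$.
   Context: Write $n = 2m+1$ and view the vertices of $K_n$ as the elements of the cyclic group $\mathbb{Z}_n=\{0,1,\dots,n-1\}$. The length of the edge between vertices $x$ and $y$ is the set $\{y-x, x-y\} = \pm(y-x)$. A Hamiltonian path in $K_n$ (equivalently, an arrangement $(h_1,\dots,h_n)$ of all elements of $\mathbb{Z}_n$, with edges $\{h_t,h_{t+1}\}$) is a terrace for $\mathbb{Z}_n$ if each edge length $\pm \ell$, for $\ell \in \{1, 2, \ldots, m\}$, occurs exactly twice among its $n-1$ edges. *)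

theory Defs
  imports "HOL-Number_Theory.Number_Theory"
begin

text \<open>
  The cyclic group of order \<open>n\<close> is represented by the least nonnegative residues \<open>{0..<int n}\<close>.
  The set \<open>pm n l\<close> consists of the residues of \<open>l\<close> and \<open>-l\<close>.
\<close>

definition pm :: "nat \<Rightarrow> int \<Rightarrow> int set" where
  "pm n l = {l mod int n, (- l) mod int n}"

definition edge_length :: "nat \<Rightarrow> int \<Rightarrow> int \<Rightarrow> int set" where
  "edge_length n x y = pm n (y - x)"

text \<open>
  A sequence \<open>h 1, \<dots>, h n\<close> is a function of which only the values on \<open>{1..n}\<close> matter.
  Edges are counted by their position \<open>t\<close>; this is the same as counting them as vertex pairs,
  since the edges of a Hamiltonian path are pairwise distinct.
\<close>

definition terrace :: "nat \<Rightarrow> (nat \<Rightarrow> int) \<Rightarrow> bool" where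
  "terrace n h \<longleftrightarrow> odd n \<and> bij_betw h {1..n} {0..<int n} \<and>
     (\<forall>l\<in>{1..(n - 1) div 2}.
        card {t \<in> {1..n - 1}. edge_length n (h t) (h (t + 1)) = pm n (int l)} = 2)"

end

theory Submission
  imports Defs
begin

text \<open>
  Put \<open>p = 2n + 1\<close>. Since the square of \<open>g\<close> has order \<open>n\<close>, reducing logarithms modulo \<open>n\<close> amounts to
  identifying \<open>x\<close> with \<open>-x\<close> modulo \<open>p\<close>. This makes \<open>d\<close> a bijection, and the edge at
  position \<open>t\<close> has length \<open>\<plusminus>l\<close> iff \<open>(t + 1) / t\<close> is \<open>v\<close> or \<open>1 / v\<close> modulo \<open>p\<close> with
  \<open>v = g ^ l\<close> or \<open>v = - g ^ l\<close>. The solutions of \<open>(t + 1) / t = v\<close> and \<open>(t + 1) / t = 1 / v\<close>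
  are exchanged by \<open>t \<mapsto> -1 - t = 2n - t\<close>, so exactly one of them lies in \<open>{1..n - 1}\<close>. Finally,
  the two choices of \<open>v\<close> give different \<open>t\<close> because \<open>v\<^sup>2 = -1\<close> is impossible for odd \<open>n\<close>.
\<close>

lemma pm_eq_iff:
  "pm n x = pm n l \<longleftrightarrow> [x = l] (mod int n) \<or> [x = - l] (mod int n)"
proof -
  have neg: "[- x = y] (mod int n) \<longleftrightarrow> [x = - y] (mod int n)" for x y
    using cong_minus_minus_iff[of x "- y" "int n"] by simp
  show ?thesis
    using neg[of x l] neg[of x "- l"] unfolding pm_def doubleton_eq_iff cong_def by auto
qed

text \<open>Doubling the exponents turns a congruence modulo \<open>n\<close> into one modulo
  \<open>2 * n\<close>, the order of \<open>g\<close>. The resulting equality of squares factors as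
  a difference of squares, and the prime modulus divides one of the two factors.\<close>

lemma cong_mod_order_half_iff:
  fixes n g a b :: nat
  assumes "prime (2 * n + 1)" "residue_primroot (2 * n + 1) g"
  shows "[a = b] (mod n) \<longleftrightarrow>
    [int g ^ a = int g ^ b] (mod int (2 * n + 1)) \<or> [int g ^ a = - (int g ^ b)] (mod int (2 * n + 1))"
proof -
  let ?p = "int (2 * n + 1)"
  have cop: "coprime (2 * n + 1) g" and ord: "ord (2 * n + 1) g = 2 * n"
    using assms by (auto simp: residue_primroot_def totient_prime)
  have p: "prime ?p" using assms(1) by (simp only: prime_nat_int_transfer)
  have "[a = b] (mod n) \<longleftrightarrow> [2 * a = 2 * b] (mod 2 * n)"
    unfolding cong_def by (simp add: mult_mod_right [symmetric])
  also have "\<dots> \<longleftrightarrow> [g ^ (2 * a) = g ^ (2 * b)] (mod (2 * n + 1))"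
    using order_divides_expdiff[OF cop, of "2 * a" "2 * b"] ord by simp
  also have "\<dots> \<longleftrightarrow> [int g ^ (2 * a) = int g ^ (2 * b)] (mod ?p)"
    by (metis cong_int_iff of_nat_power)
  also have "\<dots> \<longleftrightarrow> ?p dvd (int g ^ a - int g ^ b) * (int g ^ a + int g ^ b)"
    by (simp only: cong_iff_dvd_diff) (simp add: algebra_simps power2_eq_square power_mult mult.commute[of 2])
  also have "\<dots> \<longleftrightarrow> ?p dvd int g ^ a - int g ^ b \<or> ?p dvd int g ^ a + int g ^ b"
    using p by (rule prime_dvd_mult_iff)
  finally show ?thesis by (simp only: cong_iff_dvd_diff diff_minus_eq_add)
qed

text \<open>Both congruences are linear in \<open>t\<close>. If \<open>s\<close> inverts
  \<open>u - 1\<close> modulo \<open>p\<close>, the first says \<open>t = s\<close> and the second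
  \<open>t = -1 - s = 2 * n - s\<close> modulo \<open>p\<close>. Exactly one of these residues lies
  strictly between \<open>0\<close> and \<open>n\<close>, unless \<open>s\<close> is
  \<open>0\<close>, \<open>n\<close> or \<open>2 * n\<close>; the assumptions on \<open>u\<close>
  exclude these values.\<close>

lemma card_consecutive_ratio:
  fixes n :: nat and u :: int
  defines "p \<equiv> 2 * int n + 1"
  assumes p: "prime p" and u: "\<not> [u = 0] (mod p)" "\<not> [u = 1] (mod p)" "\<not> [u = - 1] (mod p)"
  shows "card {t \<in> {1..n - 1}. [int t + 1 = u * int t] (mod p) \<or> [int t = u * (int t + 1)] (mod p)} = 1"
    (is "card ?S = 1")
proof -
  have cop: "coprime p (u - 1)"
    using u(2) prime_imp_coprime[OF p] by (simp add: cong_iff_dvd_diff)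
  have cancel: "p dvd x" if "p dvd (u - 1) * x" for x
    using that cop by (simp add: coprime_dvd_mult_right_iff)
  obtain s' where "[(u - 1) * s' = 1] (mod p)"
    using cop coprime_commute cong_solve_coprime_int by blast
  define s where "s = s' mod p"
  have s1: "[(u - 1) * s = 1] (mod p)"
    unfolding s_def using \<open>[(u - 1) * s' = 1] (mod p)\<close> by (simp add: cong_def mod_mult_right_eq)
  have p_gt: "p > 1" using p by (rule prime_gt_1_int)
  have s_bounds: "0 \<le> s" "s < p" using p_gt by (auto simp: s_def)
  have sd: "p dvd (u - 1) * s - 1" using s1 by (simp add: cong_iff_dvd_diff)
  have s0: "s \<noteq> 0" using sd p_gt by (auto dest: zdvd_imp_le)
  \<comment> \<open>Modulo \<open>p\<close>, \<open>n\<close> is the inverse of \<open>-2\<close>,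
    so \<open>s = n\<close> would mean \<open>u - 1 = -2\<close>.\<close>
  have sn: "s \<noteq> int n"
  proof
    assume "s = int n"
    then have "p dvd 2 * ((u - 1) * int n - 1) - (u - 1) * p"
      using dvd_diff[OF dvd_mult[OF sd] dvd_triv_right] \<open>s = int n\<close> by (simp only:)
    also have "2 * ((u - 1) * int n - 1) - (u - 1) * p = - (u + 1)"
      by (simp add: p_def algebra_simps)
    finally have "p dvd u + 1" by (simp only: dvd_minus_iff)
    then show False using u(3) by (simp add: cong_iff_dvd_diff)
  qed
  \<comment> \<open>Modulo \<open>p\<close>, \<open>2 * n\<close> is \<open>-1\<close>, its own
    inverse, so this value of \<open>s\<close> would mean \<open>u = 0\<close>.\<close>
  have s2n: "s \<noteq> 2 * int n"
  proof
    assume "s = 2 * int n"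
    then have "p dvd (u - 1) * (2 * int n) - 1 - (u - 1) * p"
      using dvd_diff[OF sd dvd_triv_right] by simp
    also have "(u - 1) * (2 * int n) - 1 - (u - 1) * p = - u"
      by (simp add: p_def algebra_simps)
    finally show False using u(1) by (simp add: cong_iff_dvd_diff)
  qed
  have mem: "t \<in> ?S \<longleftrightarrow> t \<in> {1..n - 1} \<and> (p dvd (u - 1) * int t - 1 \<or> p dvd (u - 1) * (int t + 1) + 1)" for t
  proof -
    have "[int t + 1 = u * int t] (mod p) \<longleftrightarrow> p dvd - ((u - 1) * int t - 1)"
      by (simp only: cong_iff_dvd_diff) (simp add: algebra_simps)
    moreover have "[int t = u * (int t + 1)] (mod p) \<longleftrightarrow> p dvd - ((u - 1) * (int t + 1) + 1)"
      by (simp only: cong_iff_dvd_diff) (simp add: algebra_simps)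
    ultimately show ?thesis by (simp only: dvd_minus_iff mem_Collect_eq)
  qed
  have "\<exists>t. t \<in> ?S"
  proof (cases "s < int n")
    case True
    then have "nat s \<in> ?S" unfolding mem using s0 s_bounds sd by auto
    then show ?thesis by blast
  next
    \<comment> \<open>Here \<open>n < s < 2 * n\<close>, so the reflected value
      \<open>2 * n - s\<close> lies in the range and solves the second congruence.\<close>
    case False
    have "p dvd (u - 1) * p - ((u - 1) * s - 1)" using sd by (rule dvd_diff[OF dvd_triv_right])
    also have "(u - 1) * p - ((u - 1) * s - 1) = (u - 1) * (2 * int n - s + 1) + 1"
      by (simp add: p_def algebra_simps)
    finally have "nat (2 * int n - s) \<in> ?S"
      unfolding mem using False sn s2n s_bounds by (auto simp: p_def)
    then show ?thesis by blast
  qed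
  moreover have "t = t'" if "t \<in> ?S" "t' \<in> ?S" for t t'
  proof -
    have b: "1 \<le> t" "t < n" "1 \<le> t'" "t' < n" using that by auto
    have small: "x = 0" if "p dvd (u - 1) * x" "\<bar>x\<bar> < p" for x
      using cancel[OF that(1)] that(2) zdvd_not_zless[of "\<bar>x\<bar>" p] by (cases "x = 0") auto
    \<comment> \<open>Solutions of different congruences cannot coexist: adding them would make
      \<open>p\<close> divide \<open>a + b + 1\<close>, which is positive and less than
      \<open>p\<close>.\<close>
    have dist: "\<not> (p dvd (u - 1) * int a - 1 \<and> p dvd (u - 1) * (int b + 1) + 1)"
      if "a < n" "b < n" for a b
    proof
      assume "p dvd (u - 1) * int a - 1 \<and> p dvd (u - 1) * (int b + 1) + 1"
      then have "p dvd ((u - 1) * int a - 1) + ((u - 1) * (int b + 1) + 1)"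
        using dvd_add by blast
      then have "p dvd (u - 1) * (int a + int b + 1)" by (simp add: algebra_simps)
      from small[OF this] show False using that by (auto simp: p_def)
    qed
    \<comment> \<open>The parameters cover both congruences at once: \<open>k = 0\<close>,
      \<open>m = -1\<close> gives the first, \<open>k = m = 1\<close> the second.\<close>
    have eq: "a = b" if "p dvd (u - 1) * (int a + k) + m" "p dvd (u - 1) * (int b + k) + m"
      "a < n" "b < n" for a b k m
    proof -
      have "p dvd ((u - 1) * (int a + k) + m) - ((u - 1) * (int b + k) + m)"
        using that(1,2) by (rule dvd_diff)
      then have "p dvd (u - 1) * (int a - int b)" by (simp add: algebra_simps)
      from small[OF this] show "a = b" using that by (auto simp: p_def)
    qed
    show ?thesis
      using that b dist[of t t'] dist[of t' t] eq[of t 0 "-1" t'] eq[of t 1 1 t'] unfolding mem by auto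
  qed
  ultimately have "\<exists>!t. t \<in> ?S" by blast
  then show ?thesis by (auto simp: card_1_singleton_iff)
qed

theorem theorem2p3:
  fixes n g :: nat and c :: "nat \<Rightarrow> nat" and d :: "nat \<Rightarrow> int"
  assumes "odd n"
    and "prime (2 * n + 1)"
    and "residue_primroot (2 * n + 1) g"
    and "\<And>i. i \<in> {1..n} \<Longrightarrow> c i \<in> {0..<2 * n} \<and> [g ^ c i = i] (mod (2 * n + 1))"
    and "\<And>i. i \<in> {1..n} \<Longrightarrow> d i = int (c i) mod int n"
  shows "terrace n d"
proof -
  define p where "p = 2 * int n + 1"
  have p_int: "int (2 * n + 1) = p" by (simp add: p_def)
  have p: "prime p" unfolding p_int[symmetric] using assms(2) by (simp only: prime_nat_int_transfer)
  have n: "n > 0" using assms(1) by (rule odd_pos)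
  have log: "[int g ^ c i = int i] (mod p)" if "i \<in> {1..n}" for i
    using assms(4)[OF that] unfolding p_int[symmetric] by (metis cong_int_iff of_nat_power)
  note half = cong_mod_order_half_iff[OF assms(2,3), unfolded p_int]

  have inj: "inj_on d {1..n}"
  proof (rule inj_onI)
    fix i j assume ij: "i \<in> {1..n}" "j \<in> {1..n}" "d i = d j"
    then have "[c i = c j] (mod n)"
      using assms(5) by (metis cong_def cong_int_iff)
    then have "[int i = int j] (mod p) \<or> [int i = - int j] (mod p)"
      unfolding half using log[OF ij(1)] log[OF ij(2)]
      by (meson cong_minus_minus_iff cong_sym cong_trans)
    then have "p dvd int i - int j \<or> p dvd int i + int j"
      by (simp add: cong_iff_dvd_diff)
    then show "i = j"
    proof
      assume "p dvd int i - int j"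
      moreover have "\<bar>int i - int j\<bar> < p"
        using ij by (auto simp: p_def)
      ultimately have "int i - int j = 0"
        using zdvd_not_zless[of "\<bar>int i - int j\<bar>" p] by (cases "i = j") auto
      then show ?thesis by simp
    next
      \<comment> \<open>This case is void, since \<open>0 < i + j \<le> 2 * n < p\<close>.\<close>
      assume "p dvd int i + int j"
      then show ?thesis using ij zdvd_imp_le[of p "int i + int j"] by (auto simp: p_def)
    qed
  qed
  have "d ` {1..n} \<subseteq> {0..<int n}" using assms(5) n by auto
  then have "d ` {1..n} = {0..<int n}"
    by (intro card_subset_eq) (simp_all only: card_image[OF inj] finite_atLeastLessThan_int, simp)
  with inj have bij: "bij_betw d {1..n} {0..<int n}" by (simp add: bij_betw_def)

  have "card {t \<in> {1..n - 1}. edge_length n (d t) (d (t + 1)) = pm n (int l)} = 2"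
    if l: "l \<in> {1..(n - 1) div 2}" for l
  proof -
    define u where "u = int g ^ l"
    define S where "S v = {t \<in> {1..n - 1}. [int t + 1 = v * int t] (mod p) \<or> [int t = v * (int t + 1)] (mod p)}" for v
    have ndvd: "\<not> n dvd l" using l by (auto dest: dvd_imp_le)
    \<comment> \<open>Comparing the exponent \<open>l\<close> with \<open>0\<close> excludes both
      signs at once; the same comparison for \<open>2 * l\<close> below, where \<open>n\<close> is
      odd, excludes \<open>u * u = -1\<close>.\<close>
    have u1: "\<not> [u = 1] (mod p)" "\<not> [u = - 1] (mod p)"
      using half[of l 0] ndvd by (auto simp: u_def cong_0_iff)
    have "\<not> n dvd 2 * l"
      using ndvd assms(1) by (simp add: coprime_dvd_mult_right_iff)
    then have u2: "\<not> [u * u = - 1] (mod p)"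
      using half[of "2 * l" 0] by (auto simp: u_def cong_0_iff mult_2 power_add)
    have "coprime p (int g)"
      using assms(3) unfolding p_int[symmetric] by (simp only: residue_primroot_def coprime_int_iff)
    then have copu: "coprime p u" by (simp add: u_def)
    then have u0: "\<not> [u = 0] (mod p)"
      using p by (auto simp: cong_0_iff not_prime_unit dest: coprime_absorb_left)
    have "card (S u) = 1"
      using card_consecutive_ratio[of n u, folded p_def, OF p u0 u1] by (simp only: S_def)
    moreover have "card (S (- u)) = 1"
    proof -
      have "\<not> [- u = 0] (mod p)" "\<not> [- u = 1] (mod p)" "\<not> [- u = - 1] (mod p)"
        using u0 u1 cong_minus_minus_iff[of u 0 p] cong_minus_minus_iff[of u "-1" p]
          cong_minus_minus_iff[of u 1 p] by auto
      then show ?thesis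
        using card_consecutive_ratio[of n "- u", folded p_def, OF p] by (simp only: S_def simp_thms)
    qed
    moreover have "S u \<inter> S (- u) = {}"
    proof -
      have False if t: "t \<in> {1..n - 1}"
        and a: "[int t + 1 = u * int t] (mod p) \<or> [int t = u * (int t + 1)] (mod p)"
        and b: "[int t + 1 = - u * int t] (mod p) \<or> [int t = - u * (int t + 1)] (mod p)" for t
      proof -
        define x y where "x = int t" and "y = int t + 1"
        have small: "\<not> p dvd x" "\<not> p dvd y" "\<not> p dvd 2"
          using t zdvd_imp_le[of p x] zdvd_imp_le[of p y] zdvd_imp_le[of p 2]
          by (auto simp: x_def y_def p_def)
        \<comment> \<open>If \<open>t\<close> satisfies congruences of the same shape for
          \<open>u\<close> and \<open>- u\<close>, adding them gives \<open>2 * z = 0\<close>. For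
          opposite shapes, treated next, substitution gives
          \<open>z * (u * u + 1) = 0\<close>.\<close>
        have same: False if "[z = u * w] (mod p)" "[z = - u * w] (mod p)" "\<not> p dvd z" for z w
        proof -
          have "p dvd (z - u * w) + (z - (- u * w))"
            using that(1,2) by (intro dvd_add) (simp_all only: cong_iff_dvd_diff)
          then have "p dvd 2 * z" by simp
          then show False using p small(3) that(3) by (simp add: prime_dvd_mult_iff)
        qed
        have mixed: False if "[z = u * w] (mod p)" "[w = - u * z] (mod p)" "\<not> p dvd z" for z w
        proof -
          have "p dvd (z - u * w) + u * (w - (- u * z))"
            using that(1,2) by (intro dvd_add dvd_mult) (simp_all only: cong_iff_dvd_diff)
          then have "p dvd z * (u * u + 1)" by (simp add: algebra_simps)
          then show False using p u2 that(3) by (simp add: prime_dvd_mult_iff cong_iff_dvd_diff)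
        qed
        show False
          using a b same[of y x] same[of x y] mixed[of y x] mixed[of x y] small
          unfolding x_def y_def by blast
      qed
      then show ?thesis unfolding S_def by blast
    qed
    moreover have "finite (S v)" for v by (simp add: S_def)
    ultimately have "card (S u \<union> S (- u)) = 2" by (simp add: card_Un_disjoint)
    moreover have "edge_length n (d t) (d (t + 1)) = pm n (int l) \<longleftrightarrow>
        [int t + 1 = u * int t] (mod p) \<or> [int t = u * (int t + 1)] (mod p) \<or>
        [int t + 1 = - u * int t] (mod p) \<or> [int t = - u * (int t + 1)] (mod p)"
      if t: "t \<in> {1..n - 1}" for t
    proof -
      have t': "t \<in> {1..n}" "t + 1 \<in> {1..n}" using t by auto
      have logs: "[int g ^ c t = int t] (mod p)" "[int g ^ c (t + 1) = int t + 1] (mod p)"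
        using log[OF t'(1)] log[OF t'(2)] by (simp_all add: add.commute)
      \<comment> \<open>This replaces powers of \<open>g\<close> by the integers they represent and
        moves the sign supplied by \<open>half\<close> onto the multiplier \<open>v\<close>.\<close>
      have transfer: "[x * v = y] (mod p) \<longleftrightarrow> [y' = v * x'] (mod p)"
        "[x * v = - y] (mod p) \<longleftrightarrow> [y' = - v * x'] (mod p)"
        if "[x = x'] (mod p)" "[y = y'] (mod p)" for x y x' y' v
      proof -
        have "[x * v = v * x'] (mod p)" using that(1) by (simp add: mult.commute cong_scalar_left)
        moreover have "[- (x * v) = - v * x'] (mod p)"
          using calculation cong_minus_minus_iff by fastforce
        ultimately show "[x * v = y] (mod p) \<longleftrightarrow> [y' = v * x'] (mod p)"
          "[x * v = - y] (mod p) \<longleftrightarrow> [y' = - v * x'] (mod p)"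
          using that(2) cong_minus_minus_iff[of "x * v" "- y" p]
          by (auto intro: cong_trans cong_sym) (metis cong_sym cong_trans minus_minus)+
      qed
      have dd: "[d (t + 1) - d t = int (c (t + 1)) - int (c t)] (mod int n)"
        using assms(5)[OF t'(1)] assms(5)[OF t'(2)] by (simp add: cong_def mod_diff_eq)
      have "edge_length n (d t) (d (t + 1)) = pm n (int l) \<longleftrightarrow>
          [int (c (t + 1)) - int (c t) = int l] (mod int n) \<or>
          [int (c (t + 1)) - int (c t) = - int l] (mod int n)"
        unfolding edge_length_def pm_eq_iff using dd by (meson cong_sym cong_trans)
      \<comment> \<open>Since \<open>half\<close> speaks of natural exponents, each difference is
        rewritten as a sum. Each of the two resulting congruences then splits into two signs, which
        yields the four alternatives.\<close>
      also have "[int (c (t + 1)) - int (c t) = int l] (mod int n) \<longleftrightarrow> [c t + l = c (t + 1)] (mod n)"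
        unfolding cong_int_iff[symmetric]
        by (subst (2) cong_sym_eq) (simp only: cong_iff_dvd_diff of_nat_add diff_diff_eq)
      also have "[int (c (t + 1)) - int (c t) = - int l] (mod int n) \<longleftrightarrow> [c (t + 1) + l = c t] (mod n)"
        unfolding cong_int_iff[symmetric]
        by (simp only: cong_iff_dvd_diff of_nat_add diff_minus_eq_add) (simp add: algebra_simps)
      finally show ?thesis
        unfolding half power_add u_def[symmetric]
          transfer[OF logs(1) logs(2)] transfer[OF logs(2) logs(1)] by blast
    qed
    then have "{t \<in> {1..n - 1}. edge_length n (d t) (d (t + 1)) = pm n (int l)} = S u \<union> S (- u)"
      unfolding S_def by blast
    ultimately show ?thesis by simp
  qed
  then show ?thesis using assms(1) bij by (auto simp: terrace_def)
qed

end
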